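(* Let $G$ be a connected $P_5$-free chordal bipartite graph with bipartition $(A,B)$ such that $|A|=|B|$ or $|A|=|B|+1$. If $c(G-S)\le|S|+1$ for every non-empty subset $S\subseteq V(G)$, then $G$ has a Hamiltonian path.
   Context: Graphs are finite, simple and undirected. A bipartite graph is chordal bipartite if every cycle of length at least six has a chord. $P_5$-free means no induced path on five vertices. For $S\subseteq V(G)$, $c(G-S)$ denotes the number of connected components of the subgraph induced on $V(G)\setminus S$. *)

theory Defs
  imports "Graph_Theory.Graph_Theory"
begin

text \<open>
  A finite simple undirected graph is a term \<open>G\<close> satisfying the library predicate
  \<open>graph G\<close>: a finite, loop-free digraph without parallel arcs whose arc relation is symmetric.
  An undirected edge is thus a pair of mutually reverse arcs.
\<close>

definition bipartition :: "('a, 'b) pre_digraph \<Rightarrow> 'a set \<Rightarrow> 'a set \<Rightarrow> bool" where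
  "bipartition G A B \<longleftrightarrow> A \<union> B = verts G \<and> A \<inter> B = {} \<and>
     (\<forall>u v. u \<rightarrow>\<^bsub>G\<^esub> v \<longrightarrow> u \<in> A \<and> v \<in> B \<or> u \<in> B \<and> v \<in> A)"

text \<open>
  A cycle is a list of arcs, so its vertices are the tails of its arcs. A chord is an edge between
  two of these vertices that, in either orientation, is not an edge of the cycle.
\<close>

definition has_chord :: "('a, 'b) pre_digraph \<Rightarrow> 'b awalk \<Rightarrow> bool" where
  "has_chord G c \<longleftrightarrow>
     (\<exists>u \<in> tail G ` set c. \<exists>v \<in> tail G ` set c. u \<rightarrow>\<^bsub>G\<^esub> v \<and>
        (\<forall>e \<in> set c. {tail G e, head G e} \<noteq> {u, v}))"

text \<open>
  The library's \<open>cycle\<close> also admits the closed walk \<open>u, v, u\<close> along a single edge; the bound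
  on the length excludes it here.
\<close>

definition chordal_bipartite :: "('a, 'b) pre_digraph \<Rightarrow> bool" where
  "chordal_bipartite G \<longleftrightarrow> (\<exists>A B. bipartition G A B) \<and>
     (\<forall>c. pre_digraph.cycle G c \<and> length c \<ge> 6 \<longrightarrow> has_chord G c)"

definition induced_path :: "('a, 'b) pre_digraph \<Rightarrow> 'a vwalk \<Rightarrow> bool" where
  "induced_path G p \<longleftrightarrow> vpath p G \<and>
     (\<forall>i < length p. \<forall>j < length p. p ! i \<rightarrow>\<^bsub>G\<^esub> p ! j \<longrightarrow> j = Suc i \<or> i = Suc j)"

definition P5_free :: "('a, 'b) pre_digraph \<Rightarrow> bool" where
  "P5_free G \<longleftrightarrow> \<not> (\<exists>p. induced_path G p \<and> length p = 5)"

text \<open>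
  For symmetric \<open>G\<close> the induced subgraph is symmetric as well, so its strongly connected
  components are its connected components.
\<close>

definition num_components_minus :: "('a, 'b) pre_digraph \<Rightarrow> 'a set \<Rightarrow> nat" where
  "num_components_minus G S = card (pre_digraph.sccs (G \<restriction> (verts G - S)))"

definition has_hamiltonian_path :: "('a, 'b) pre_digraph \<Rightarrow> bool" where
  "has_hamiltonian_path G \<longleftrightarrow> (\<exists>p. vpath p G \<and> set p = verts G)"

end

theory Submission
  imports Defs
begin

text \<open>
  A connected \<open>P\<^sub>5\<close>-free bipartite graph is a chain graph: the neighbourhoods of the vertices of \<open>A\<close>
  are nested. Removing \<open>S = N(a)\<close> isolates every \<open>a'\<close> with \<open>N(a') \<subseteq> N(a)\<close> and leaves a further
  component unless \<open>N(a) = B\<close>; so the hypothesis bounds the number of these \<open>a'\<close> by \<open>|N(a)|\<close>.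
  Sorting \<open>A\<close> by increasing and \<open>B\<close> by decreasing neighbourhoods, \<open>a\<^sub>i\<close> is therefore adjacent to
  \<open>b\<^sub>j\<close> whenever \<open>j \<le> i\<close>, and \<open>a\<^sub>0, b\<^sub>0, a\<^sub>1, b\<^sub>1, \<dots>\<close> is a Hamiltonian path.
\<close>

section \<open>Ordering nested set families\<close>

text \<open>Sorting by cardinality suffices: of two comparable finite sets, the one of no larger
  cardinality is contained in the other.\<close>

lemma nested_family_enumeration:
  fixes F :: "'a \<Rightarrow> 'b set"
  assumes "finite A"
    and fin: "\<And>x. x \<in> A \<Longrightarrow> finite (F x)"
    and nested: "\<And>x y. x \<in> A \<Longrightarrow> y \<in> A \<Longrightarrow> F x \<subseteq> F y \<or> F y \<subseteq> F x"
  obtains xs where "distinct xs" "set xs = A"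
    "\<And>i j. i \<le> j \<Longrightarrow> j < length xs \<Longrightarrow> F (xs ! i) \<subseteq> F (xs ! j)"
proof -
  obtain ys where ys: "set ys = A" "distinct ys"
    using finite_distinct_list[OF \<open>finite A\<close>] by blast
  define xs where "xs = sort_key (\<lambda>x. card (F x)) ys"
  have set_xs: "set xs = A" "distinct xs"
    using ys by (simp_all add: xs_def)
  have "F (xs ! i) \<subseteq> F (xs ! j)" if "i \<le> j" "j < length xs" for i j
  proof -
    have mem: "xs ! i \<in> A" "xs ! j \<in> A"
      using that set_xs(1) by (metis nth_mem order.strict_trans1)+
    have "sorted (map (\<lambda>x. card (F x)) xs)"
      by (simp add: xs_def)
    then have "card (F (xs ! i)) \<le> card (F (xs ! j))"
      using that by (auto dest: sorted_nth_mono)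
    then show ?thesis
      using nested[OF mem] card_seteq fin mem by blast
  qed
  with set_xs show thesis by (intro that)
qed

text \<open>A counting argument: if a_i missed b_j with j \<le> i, its neighbourhood would fit into
  the j entries before b_j, yet at least i + 1 neighbourhoods lie inside it. \<open>large\<close> is
  the form in which the component condition enters; it exempts \<open>N a = B\<close>, where nothing
  can be missed.\<close>

lemma staircase_enumeration:
  fixes N :: "'a \<Rightarrow> 'b set"
  assumes "finite A" "finite B"
    and sub: "\<And>a. a \<in> A \<Longrightarrow> N a \<subseteq> B"
    and nested: "\<And>a a'. a \<in> A \<Longrightarrow> a' \<in> A \<Longrightarrow> N a \<subseteq> N a' \<or> N a' \<subseteq> N a"
    and large: "\<And>a. a \<in> A \<Longrightarrow> N a \<noteq> B \<Longrightarrow> card {a' \<in> A. N a' \<subseteq> N a} \<le> card (N a)"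
  obtains as bs where "distinct as" "set as = A" "distinct bs" "set bs = B"
    "\<And>i j. j \<le> i \<Longrightarrow> i < length as \<Longrightarrow> j < length bs \<Longrightarrow> bs ! j \<in> N (as ! i)"
proof -
  \<comment> \<open>Non-neighbours in \<open>A\<close>: increasing \<open>?M\<close> means
    decreasing neighbourhoods, so the same enumeration lemma orders \<open>B\<close>.\<close>
  let ?M = "\<lambda>b. {a \<in> A. b \<notin> N a}"
  have finN: "finite (N a)" if "a \<in> A" for a
    using sub[OF that] \<open>finite B\<close> by (rule finite_subset)
  obtain as where as: "distinct as" "set as = A"
    and as_mono: "\<And>i j. i \<le> j \<Longrightarrow> j < length as \<Longrightarrow> N (as ! i) \<subseteq> N (as ! j)"
    using nested_family_enumeration[of A N, OF \<open>finite A\<close> finN nested] by blast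
  \<comment> \<open>Witnesses a, a' against nestedness of \<open>?M b\<close> and
    \<open>?M b'\<close> would have incomparable neighbourhoods.\<close>
  have nestedM: "?M b \<subseteq> ?M b' \<or> ?M b' \<subseteq> ?M b" for b b'
    using nested by blast
  have finM: "finite (?M b)" for b
    using \<open>finite A\<close> by simp
  obtain bs where bs: "distinct bs" "set bs = B"
    and bs_mono: "\<And>i j. i \<le> j \<Longrightarrow> j < length bs \<Longrightarrow> ?M (bs ! i) \<subseteq> ?M (bs ! j)"
    using nested_family_enumeration[of B ?M, OF \<open>finite B\<close> finM nestedM] by blast
  have "bs ! j \<in> N (as ! i)" if ij: "j \<le> i" "i < length as" "j < length bs" for i j
  proof (rule ccontr)
    assume notin: "bs ! j \<notin> N (as ! i)"
    have asi: "as ! i \<in> A"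
      using ij as by auto
    have "N (as ! i) \<noteq> B"
      using notin bs ij by auto
    have "N (as ! i) \<subseteq> (!) bs ` {..<j}"
    proof
      fix b assume b: "b \<in> N (as ! i)"
      then obtain k where k: "k < length bs" "b = bs ! k"
        using sub[OF asi] bs by (metis in_set_conv_nth subsetD)
      \<comment> \<open>If j \<le> k, then \<open>?M (bs ! j) \<subseteq> ?M (bs ! k)\<close>, so
        a_i would miss b_k as well.\<close>
      have "k < j"
        using bs_mono[of j k] k b notin asi by (auto simp: not_less[symmetric])
      then show "b \<in> (!) bs ` {..<j}"
        using k by auto
    qed
    then have "card (N (as ! i)) \<le> j"
      using surj_card_le[of "{..<j}"] by simp
    moreover have "(!) as ` {..i} \<subseteq> {a' \<in> A. N a' \<subseteq> N (as ! i)}"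
      using as_mono ij as by auto
    then have "card ((!) as ` {..i}) \<le> card {a' \<in> A. N a' \<subseteq> N (as ! i)}"
      using \<open>finite A\<close> by (intro card_mono) auto
    moreover have "card ((!) as ` {..i}) = Suc i"
      using as ij by (subst card_image) (auto intro!: inj_on_nth)
    \<comment> \<open>The indices up to i give i + 1 distinct vertices, whence i + 1 \<le> j \<le>
      i.\<close>
    ultimately show False
      using large[OF asi \<open>N (as ! i) \<noteq> B\<close>] ij by linarith
  qed
  then show thesis
    using as bs by (intro that)
qed

section \<open>Interleaving two lists into a path\<close>

lemma vwalk_nthI:
  assumes "p \<noteq> []" "set p \<subseteq> verts G"
    and "\<And>i. Suc i < length p \<Longrightarrow> p ! i \<rightarrow>\<^bsub>G\<^esub> p ! Suc i"
  shows "vwalk p G"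
  using assms
proof (induction p rule: vwalk_arcs.induct)
  case (3 x y xs)
  have "vwalk (y # xs) G"
    using "3.prems"(2) "3.prems"(3)[of "Suc i" for i] by (intro "3.IH") simp_all
  moreover have "x \<rightarrow>\<^bsub>G\<^esub> y"
    using "3.prems"(3)[of 0] by simp
  ultimately show ?case
    using "3.prems"(2) by (auto simp: vwalk_def)
qed (auto simp: vwalk_def)

text \<open>The order a_0, b_0, a_1, b_1, ... uses only edges between a_i and b_i and between b_i
  and a_{i+1}; the length condition lets it start in \<open>as\<close> and exhaust both
  lists.\<close>

lemma alternating_vpath:
  assumes as: "distinct as" "set as = A" and bs: "distinct bs" "set bs = B"
    and "A \<inter> B = {}" "A \<union> B = verts G" "as \<noteq> []"
    and len: "length as = length bs \<or> length as = Suc (length bs)"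
    and fwd: "\<And>i. i < length as \<Longrightarrow> i < length bs \<Longrightarrow> as ! i \<rightarrow>\<^bsub>G\<^esub> bs ! i"
    and bwd: "\<And>i. Suc i < length as \<Longrightarrow> i < length bs \<Longrightarrow> bs ! i \<rightarrow>\<^bsub>G\<^esub> as ! Suc i"
  shows "has_hamiltonian_path G"
proof -
  define n where "n = length as + length bs"
  define f where "f k = (if even k then as ! (k div 2) else bs ! (k div 2))" for k
  have ev: "k div 2 < length as" if "k < n" "even k" for k
    using that len unfolding n_def by auto
  have od: "k div 2 < length bs" if "k < n" "odd k" for k
    using that len unfolding n_def by (auto elim!: oddE)
  have inA: "f k \<in> A" if "k < n" "even k" for k
    using ev[OF that] as that by (auto simp: f_def)
  have inB: "f k \<in> B" if "k < n" "odd k" for k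
    using od[OF that] bs that by (auto simp: f_def)
  have inj: "inj_on f {..<n}"
  proof (rule inj_onI)
    fix k l assume kl: "k \<in> {..<n}" "l \<in> {..<n}" "f k = f l"
    \<comment> \<open>As \<open>A\<close> and \<open>B\<close> are disjoint, the side of a vertex
      reveals the parity of its position.\<close>
    then have par: "even k \<longleftrightarrow> even l"
      using inA inB \<open>A \<inter> B = {}\<close> by (metis disjoint_iff lessThan_iff)
    have "k div 2 = l div 2"
    proof (cases "even k")
      case True
      then show ?thesis
        using kl par ev as by (auto simp: f_def nth_eq_iff_index_eq)
    next
      case False
      then show ?thesis
        using kl par od bs by (auto simp: f_def nth_eq_iff_index_eq)
    qed
    then show "k = l"
      using par by (metis div_mult_mod_eq parity_cases)
  qed
  let ?p = "map f [0..<n]"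
  have "set ?p \<subseteq> verts G"
    using inA inB \<open>A \<union> B = verts G\<close> by fastforce
  moreover have "verts G \<subseteq> set ?p"
  proof
    fix v assume "v \<in> verts G"
    then consider "v \<in> A" | "v \<in> B"
      using \<open>A \<union> B = verts G\<close> by blast
    then show "v \<in> set ?p"
    proof cases
      case 1
      then obtain i where "i < length as" "v = as ! i"
        using as by (metis in_set_conv_nth)
      then have "v = f (2 * i)" "2 * i < n"
        using len by (auto simp: f_def n_def)
      then show ?thesis by auto
    next
      case 2
      then obtain i where "i < length bs" "v = bs ! i"
        using bs by (metis in_set_conv_nth)
      then have "v = f (Suc (2 * i))" "Suc (2 * i) < n"
        using len by (auto simp: f_def n_def)
      then show ?thesis by auto
    qed
  qed
  ultimately have "set ?p = verts G" by blast
  moreover have "vwalk ?p G"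
  proof (rule vwalk_nthI)
    show "?p \<noteq> []"
      using \<open>as \<noteq> []\<close> by (simp add: n_def)
    show "set ?p \<subseteq> verts G" by fact
    fix k assume k: "Suc k < length ?p"
    have "f k \<rightarrow>\<^bsub>G\<^esub> f (Suc k)"
    proof (cases "even k")
      case True
      then show ?thesis
        using fwd[of "k div 2"] ev[of k] od[of "Suc k"] k by (simp add: f_def)
    next
      case False
      \<comment> \<open>For odd \<open>k\<close>, \<open>Suc k div 2\<close> is
        \<open>Suc (k div 2)\<close>, so the step goes to the next entry of
        \<open>as\<close>.\<close>
      then show ?thesis
        using bwd[of "k div 2"] od[of k] ev[of "Suc k"] k by (simp add: f_def)
    qed
    then show "?p ! k \<rightarrow>\<^bsub>G\<^esub> ?p ! Suc k"
      using k by simp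
  qed
  moreover have "distinct ?p"
    using inj by (simp add: distinct_map atLeast_upt)
  ultimately show ?thesis
    unfolding has_hamiltonian_path_def vpath_def by blast
qed

section \<open>Lower bounds on the number of components\<close>

lemma (in fin_digraph) card_le_card_sccs:
  assumes "I \<subseteq> verts G"
    and sep: "\<And>u v. u \<in> I \<Longrightarrow> v \<in> I \<Longrightarrow> u \<rightarrow>\<^sup>*\<^bsub>G\<^esub> v \<Longrightarrow> u = v"
  shows "card I \<le> card sccs"
proof -
  have "inj_on scc_of I"
  proof (rule inj_onI)
    fix u v assume uv: "u \<in> I" "v \<in> I" "scc_of u = scc_of v"
    then have "v \<in> scc_of u"
      using \<open>I \<subseteq> verts G\<close> in_scc_of_self by blast
    then show "u = v"
      using sep uv by (simp add: scc_of_def)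
  qed
  moreover have "scc_of ` I \<subseteq> sccs_verts"
    using \<open>I \<subseteq> verts G\<close> scc_of_in_sccs_verts by blast
  ultimately have "card I \<le> card sccs_verts"
    using finite_sccs_verts by (metis card_image card_mono)
  then show ?thesis
    by (simp add: card_sccs_verts)
qed

text \<open>Each vertex of \<open>I\<close> is isolated once \<open>S\<close> is deleted, and
  \<open>b\<close> lies in a further component. This extra one later cancels the + 1 in the bound on
  components.\<close>

lemma (in graph) card_isolated_le_num_components_minus:
  assumes "I \<subseteq> verts G - S" "b \<in> verts G - S" "b \<notin> I"
    and nbrs: "\<And>a v. a \<in> I \<Longrightarrow> a \<rightarrow>\<^bsub>G\<^esub> v \<Longrightarrow> v \<in> S"
  shows "Suc (card I) \<le> num_components_minus G S"
proof -
  define H where "H = G \<restriction> (verts G - S)"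
  have "induced_subgraph H G"
    unfolding H_def by (rule induced_induce) blast
  then interpret H: digraph H + H: sym_digraph H
    by (auto intro: digraphI_induced induced_graph_imp_graph)
  have dead_end: "v = a" if "a \<in> I" "a \<rightarrow>\<^sup>*\<^bsub>H\<^esub> v" for a v
    using that(2)
  proof (cases rule: H.converse_reachable_cases)
    case (step w)
    then have "a \<rightarrow>\<^bsub>G\<^esub> w" "w \<in> verts H"
      using dominates_induce_subgraphD[of a w G "verts G - S"] H.adj_in_verts(2)[of a w]
      by (auto simp: H_def)
    then show ?thesis
      using nbrs \<open>a \<in> I\<close> by (auto simp: H_def)
  qed simp
  \<comment> \<open>A walk starting at \<open>b\<close> and ending in \<open>I\<close> is reversed
    by symmetry, so that \<open>dead_end\<close> applies.\<close>
  have "u = v" if "u \<in> insert b I" "v \<in> insert b I" "u \<rightarrow>\<^sup>*\<^bsub>H\<^esub> v" for u v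
    using that dead_end symmetric_reachable[OF H.sym_arcs \<open>u \<rightarrow>\<^sup>*\<^bsub>H\<^esub> v\<close>] by blast
  then have "card (insert b I) \<le> card H.sccs"
    using assms by (intro H.card_le_card_sccs) (auto simp: H_def)
  moreover have "finite I"
    using assms(1) finite_verts finite_subset by blast
  ultimately show ?thesis
    using \<open>b \<notin> I\<close> by (simp add: num_components_minus_def H_def)
qed

section \<open>Nested neighbourhoods from \<open>P5_free\<close>\<close>

lemma bipartition_swap: "bipartition G A B \<Longrightarrow> bipartition G B A"
  unfolding bipartition_def by blast

text \<open>On b, a, x, a', b' there are six pairs across the bipartition: four are edges of the
  path and the other two are the assumed nonedges, so the path is induced.\<close>

lemma (in graph) bipartite_P5_free_no_induced:
  assumes "P5_free G" "bipartition G A B" "b \<in> B"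
    and edges: "b \<rightarrow>\<^bsub>G\<^esub> a" "a \<rightarrow>\<^bsub>G\<^esub> x" "x \<rightarrow>\<^bsub>G\<^esub> a'" "a' \<rightarrow>\<^bsub>G\<^esub> b'"
    and nonedges: "\<not> a \<rightarrow>\<^bsub>G\<^esub> b'" "\<not> a' \<rightarrow>\<^bsub>G\<^esub> b"
  shows False
proof -
  have parts: "A \<union> B = verts G" "A \<inter> B = {}"
    and bip: "\<And>u v. u \<rightarrow>\<^bsub>G\<^esub> v \<Longrightarrow> u \<in> A \<and> v \<in> B \<or> u \<in> B \<and> v \<in> A"
    using \<open>bipartition G A B\<close> unfolding bipartition_def by blast+
  have sym: "u \<rightarrow>\<^bsub>G\<^esub> v \<Longrightarrow> v \<rightarrow>\<^bsub>G\<^esub> u" for u v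
    by (rule graph_symmetric)
  have mem: "a \<in> A" "x \<in> B" "a' \<in> A" "b' \<in> B"
    using bip edges parts \<open>b \<in> B\<close> by blast+
  have AA: "\<not> u \<rightarrow>\<^bsub>G\<^esub> v" if "u \<in> A" "v \<in> A" for u v
    using bip parts that by blast
  have BB: "\<not> u \<rightarrow>\<^bsub>G\<^esub> v" if "u \<in> B" "v \<in> B" for u v
    using bip parts that by blast
  let ?p = "[b, a, x, a', b']"
  \<comment> \<open>Each pair is told apart by a vertex adjacent to one of the two but not to the
    other.\<close>
  have "a \<noteq> a'" "b \<noteq> x" "b \<noteq> b'" "x \<noteq> b'"
    using edges nonedges sym by blast+
  moreover have "a \<notin> B" "a' \<notin> B"
    using mem parts by blast+
  ultimately have "distinct ?p"
    using mem \<open>b \<in> B\<close> by auto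
  moreover have "vwalk ?p G"
    using edges mem parts \<open>b \<in> B\<close> by (auto simp: vwalk_def)
  moreover have "j = Suc i \<or> i = Suc j"
    if "i < length ?p" "j < length ?p" "?p ! i \<rightarrow>\<^bsub>G\<^esub> ?p ! j" for i j
    using that AA BB mem \<open>b \<in> B\<close> nonedges sym
    by (auto simp: less_Suc_eq numeral_eq_Suc)
  ultimately have "induced_path G ?p" "length ?p = 5"
    unfolding induced_path_def vpath_def by auto
  then show False
    using \<open>P5_free G\<close> unfolding P5_free_def by blast
qed

text \<open>Incomparable neighbourhoods with a common element x give an induced path: private
  neighbour, u, x, v, private neighbour. Connectedness provides a common neighbour for any two
  distinct vertices of \<open>A\<close>.\<close>

lemma (in graph) connected_P5_free_nested:
  assumes "connected G" "P5_free G" "bipartition G A B" "a \<in> A" "a' \<in> A"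
  shows "{b. a \<rightarrow>\<^bsub>G\<^esub> b} \<subseteq> {b. a' \<rightarrow>\<^bsub>G\<^esub> b} \<or> {b. a' \<rightarrow>\<^bsub>G\<^esub> b} \<subseteq> {b. a \<rightarrow>\<^bsub>G\<^esub> b}"
proof -
  let ?N = "\<lambda>a. {b. a \<rightarrow>\<^bsub>G\<^esub> b}"
  have parts: "A \<union> B = verts G" "A \<inter> B = {}"
    and bip: "\<And>u v. u \<rightarrow>\<^bsub>G\<^esub> v \<Longrightarrow> u \<in> A \<and> v \<in> B \<or> u \<in> B \<and> v \<in> A"
    using \<open>bipartition G A B\<close> unfolding bipartition_def by blast+
  note sym = graph_symmetric
  have common: "?N u \<subseteq> ?N v \<or> ?N v \<subseteq> ?N u"
    if "u \<in> A" "u \<rightarrow>\<^bsub>G\<^esub> x" "v \<rightarrow>\<^bsub>G\<^esub> x" for u v x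
  proof (rule ccontr)
    assume "\<not> ?thesis"
    then obtain c d where "u \<rightarrow>\<^bsub>G\<^esub> c" "\<not> v \<rightarrow>\<^bsub>G\<^esub> c" "v \<rightarrow>\<^bsub>G\<^esub> d" "\<not> u \<rightarrow>\<^bsub>G\<^esub> d" by blast
    moreover from this have "c \<in> B"
      using bip parts \<open>u \<in> A\<close> by blast
    ultimately show False
      using bipartite_P5_free_no_induced[OF assms(2,3), of c u x v d] that sym by blast
  qed
  \<comment> \<open>Having a common neighbour is transitive on \<open>A\<close>: otherwise \<open>u, x, v, y, w\<close> is an induced path.\<close>
  have trans: "\<exists>z. u \<rightarrow>\<^bsub>G\<^esub> z \<and> w \<rightarrow>\<^bsub>G\<^esub> z"
    if "u \<in> A" "u \<rightarrow>\<^bsub>G\<^esub> x" "v \<rightarrow>\<^bsub>G\<^esub> x" "v \<rightarrow>\<^bsub>G\<^esub> y" "w \<rightarrow>\<^bsub>G\<^esub> y" for u v w x y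
    using bipartite_P5_free_no_induced[OF assms(2) bipartition_swap[OF assms(3)], of u x v y w]
      that sym by blast
  \<comment> \<open>Induction along a walk from \<open>a\<close>. The clause for \<open>B\<close>
    carries the claim across the intermediate vertices: it remembers a neighbour that already shares
    a neighbour with \<open>a\<close>.\<close>
  have "(v \<in> A \<longrightarrow> v = a \<or> (\<exists>z. a \<rightarrow>\<^bsub>G\<^esub> z \<and> v \<rightarrow>\<^bsub>G\<^esub> z)) \<and>
        (v \<in> B \<longrightarrow> (\<exists>u z. u \<rightarrow>\<^bsub>G\<^esub> v \<and> a \<rightarrow>\<^bsub>G\<^esub> z \<and> u \<rightarrow>\<^bsub>G\<^esub> z))" if "a \<rightarrow>\<^sup>*\<^bsub>G\<^esub> v" for v
    using that
  proof (induction rule: reachable_induct)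
    case base
    then show ?case
      using parts \<open>a \<in> A\<close> by blast
  next
    case (step v w)
    show ?case
    proof (intro conjI impI)
      assume "w \<in> A"
      then have "v \<in> B"
        using bip step.hyps parts by blast
      then obtain u z where "u \<rightarrow>\<^bsub>G\<^esub> v" "a \<rightarrow>\<^bsub>G\<^esub> z" "u \<rightarrow>\<^bsub>G\<^esub> z"
        using step.IH by blast
      then show "w = a \<or> (\<exists>z. a \<rightarrow>\<^bsub>G\<^esub> z \<and> w \<rightarrow>\<^bsub>G\<^esub> z)"
        using trans[of a z u v w] \<open>a \<in> A\<close> sym step.hyps by blast
    next
      assume "w \<in> B"
      then have "v \<in> A"
        using bip step.hyps parts by blast
      then show "\<exists>u z. u \<rightarrow>\<^bsub>G\<^esub> w \<and> a \<rightarrow>\<^bsub>G\<^esub> z \<and> u \<rightarrow>\<^bsub>G\<^esub> z"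
        using step by blast
    qed
  qed
  moreover have "a \<rightarrow>\<^sup>*\<^bsub>G\<^esub> a'"
    using symmetric_connected_imp_strongly_connected[OF sym_arcs \<open>connected G\<close>] assms(4,5) parts
    by (auto simp: strongly_connected_def)
  ultimately show ?thesis
    using common \<open>a \<in> A\<close> \<open>a' \<in> A\<close> by blast
qed

section \<open>Assembling the Hamiltonian path\<close>

theorem theorem6:
  fixes G :: "('a, 'b) pre_digraph" and A B :: "'a set"
  assumes "graph G"
    and "connected G"
    and "P5_free G"
    and "chordal_bipartite G"
    and "bipartition G A B"
    and "card A = card B \<or> card A = card B + 1"
    and "\<And>S. S \<subseteq> verts G \<Longrightarrow> S \<noteq> {} \<Longrightarrow> num_components_minus G S \<le> card S + 1"
  shows "has_hamiltonian_path G"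
proof -
  interpret graph G by fact
  let ?N = "\<lambda>a. {b. a \<rightarrow>\<^bsub>G\<^esub> b}"
  have parts: "A \<union> B = verts G" "A \<inter> B = {}"
    and bip: "\<And>u v. u \<rightarrow>\<^bsub>G\<^esub> v \<Longrightarrow> u \<in> A \<and> v \<in> B \<or> u \<in> B \<and> v \<in> A"
    using \<open>bipartition G A B\<close> unfolding bipartition_def by blast+
  have fin: "finite A" "finite B"
    using parts finite_verts by (metis finite_Un)+
  have sub: "?N a \<subseteq> B" if "a \<in> A" for a
    using bip parts that by blast
  have large: "card {a' \<in> A. ?N a' \<subseteq> ?N a} \<le> card (?N a)" if a: "a \<in> A" "?N a \<noteq> B" for a
  proof -
    obtain b where b: "b \<in> B" "\<not> a \<rightarrow>\<^bsub>G\<^esub> b"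
      using a sub[OF \<open>a \<in> A\<close>] by blast
    have "a \<rightarrow>\<^sup>*\<^bsub>G\<^esub> b"
      using symmetric_connected_imp_strongly_connected[OF sym_arcs \<open>connected G\<close>] a(1) b parts
      by (auto simp: strongly_connected_def)
    \<comment> \<open>The component condition speaks only of non-empty sets; the first edge of a
      walk from \<open>a\<close> to \<open>b\<close> shows that \<open>?N a\<close> is one.\<close>
    then have "?N a \<noteq> {}"
      using a(1) b(1) parts by (cases rule: converse_reachable_cases) auto
    have N: "?N a \<subseteq> verts G" using sub[OF a(1)] parts by blast
    \<comment> \<open>Deleting \<open>?N a\<close> isolates every a' counted on the left, and
      \<open>b\<close> survives as the extra vertex.\<close>
    have "Suc (card {a' \<in> A. ?N a' \<subseteq> ?N a}) \<le> num_components_minus G (?N a)"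
      using b parts sub[OF \<open>a \<in> A\<close>]
      by (intro card_isolated_le_num_components_minus[of _ _ b]) auto
    also have "\<dots> \<le> card (?N a) + 1"
      using N \<open>?N a \<noteq> {}\<close> by (rule assms(7))
    finally show ?thesis by simp
  qed
  obtain as bs where as: "distinct as" "set as = A" and bs: "distinct bs" "set bs = B"
    and adj: "\<And>i j. j \<le> i \<Longrightarrow> i < length as \<Longrightarrow> j < length bs \<Longrightarrow> bs ! j \<in> ?N (as ! i)"
    using staircase_enumeration[of A B ?N, OF fin sub
        connected_P5_free_nested[OF assms(2,3,5)] large] by blast
  have len: "length as = length bs \<or> length as = Suc (length bs)"
    using assms(6) as bs distinct_card[of as] distinct_card[of bs] by simp
  have "verts G \<noteq> {}"
    using \<open>connected G\<close> by (auto simp: connected_def strongly_connected_def mk_symmetric_def)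
  then have "as \<noteq> []"
    using len as bs parts by auto
  \<comment> \<open>In \<open>adj\<close>, equal indices give the edges from a_i to b_i, and the
    pair i, i + 1 gives those from b_i to a_{i+1} after reversal.\<close>
  then show ?thesis
    using as bs parts len adj graph_symmetric
    by (intro alternating_vpath[of as A bs B]) auto
qed

end
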